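(* For every integer $n\ge 0$, the $n$-th moment $\mu_n=L_q(x^n)$ for the $q$-Charlier polynomials is given by $$ \mu_n=\sum_{\pi\in P(n)} a^{\#\mathrm{blocks}(\pi)}\, q^{rs(\pi)} . $$
   Context: Let $a,q$ be indeterminates and $[n]_q=\frac{1-q^n}{1-q}$. The $q$-Charlier polynomials $C_n(x,a;q)$ are the polynomials in $x$ defined by $C_{-1}(x,a;q)=0$, $C_0(x,a;q)=1$ and $$C_{n+1}(x,a;q)=(x-aq^n-[n]_q)\,C_n(x,a;q)-a[n]_q q^{n-1}C_{n-1}(x,a;q)\qquad(n\ge 0).$$ $L_q$ denotes the linear functional on polynomials in $x$ (over $\mathbb{Q}(a,q)$) with respect to which these polynomials are orthogonal, normalized by $L_q(1)=1$; equivalently, $L_q$ is the unique linear functional with $L_q(1)=1$ and $L_q(C_n(x,a;q))=0$ for all $n\ge 1$. $P(n)$ is the set of all set partitions of $[n]=\{1,\dots,n\}$, and $\#\mathrm{blocks}(\pi)$ is the number of blocks of $\pi$. To $\pi\in P(n)$ associate the word $w=w_1w_2\cdots w_n$ (its restricted growth function) as follows: order the blocks of $\pi$ by increasing minima and number them $1,2,\dots$ in this order; $w_i$ is the number of the block containing $i$. Then $$rs(\pi)=\sum_{i=1}^n \big|\{\,j:\ j<w_i,\ \text{the letter } j \text{ appears in } w \text{ to the right of position } i\,\}\big|$$ (distinct values $j$ are counted, not occurrences). *)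

theory Defs
  imports
    "HOL-Computational_Algebra.Polynomial"
    "HOL-Computational_Algebra.Fraction_Field"
    "HOL-Library.Disjoint_Sets"
begin

(* The field Q(a,q), realised as the fraction field of Q[a][q]: the inner polynomial
   variable is a, the outer one is q. *)
type_synonym ratfun = "rat poly poly fract"

definition var_a :: ratfun where
  "var_a = Fract [:[:0, 1:]:] 1"

definition var_q :: ratfun where
  "var_q = Fract [:0, 1:] 1"

definition q_bracket :: "'a::field \<Rightarrow> nat \<Rightarrow> 'a" where
  "q_bracket q n = (1 - q ^ n) / (1 - q)"

(* The recurrence C_(n+1) = (x - a q^n - [n]) C_n - a [n] q^(n-1) C_(n-1), unshifted for n = 0
   (where C_(-1) = 0, so that the last term is absent) and written at n + 1 otherwise. *)
fun q_charlier :: "'a::field \<Rightarrow> 'a \<Rightarrow> nat \<Rightarrow> 'a poly" where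
  "q_charlier a q 0 = 1"
| "q_charlier a q (Suc 0) = [:0, 1:] - [:a * q ^ 0 + q_bracket q 0:]"
| "q_charlier a q (Suc (Suc n)) =
     ([:0, 1:] - [:a * q ^ Suc n + q_bracket q (Suc n):]) * q_charlier a q (Suc n)
     - smult (a * q_bracket q (Suc n) * q ^ n) (q_charlier a q n)"

definition orthogonal_wrt :: "('a::field poly \<Rightarrow> 'a) \<Rightarrow> (nat \<Rightarrow> 'a poly) \<Rightarrow> bool" where
  "orthogonal_wrt L p \<longleftrightarrow>
     (\<forall>m n. m \<noteq> n \<longrightarrow> L (p m * p n) = 0) \<and> (\<forall>n. L (p n * p n) \<noteq> 0)"

definition L_q :: "ratfun poly \<Rightarrow> ratfun" where
  "L_q = (THE L. Vector_Spaces.linear smult (*) L \<and> L 1 = 1 \<and>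
                 orthogonal_wrt L (q_charlier var_a var_q))"

definition set_partitions :: "nat \<Rightarrow> nat set set set" where
  "set_partitions n = {\<pi>. partition_on {1..n} \<pi>}"

definition block_of :: "nat set set \<Rightarrow> nat \<Rightarrow> nat set" where
  "block_of \<pi> i = (THE B. B \<in> \<pi> \<and> i \<in> B)"

(* The number (starting from 1) of the block B when the blocks are ordered by increasing minima. *)
definition block_number :: "nat set set \<Rightarrow> nat set \<Rightarrow> nat" where
  "block_number \<pi> B = card {B' \<in> \<pi>. Min B' \<le> Min B}"

definition rgf :: "nat \<Rightarrow> nat set set \<Rightarrow> nat list" where
  "rgf n \<pi> = map (\<lambda>i. block_number \<pi> (block_of \<pi> i)) [1..<Suc n]"

(* List positions start from 0 rather than 1. *)
definition rs_word :: "nat list \<Rightarrow> nat" where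
  "rs_word w = (\<Sum>i<length w. card {j. j < w ! i \<and> (\<exists>k. i < k \<and> k < length w \<and> w ! k = j)})"

definition rs :: "nat \<Rightarrow> nat set set \<Rightarrow> nat" where
  "rs n \<pi> = rs_word (rgf n \<pi>)"

end

theory Submission
  imports Defs
begin

text \<open>
  Both sides equal the sum of \<open>S n k * a ^ k\<close>, where \<open>S\<close> are the \<open>q\<close>-Stirling numbers with
  \<open>S (n + 1) k = S n (k - 1) + [k] S n k\<close>.

  On the algebraic side, let \<open>\<phi> k = (x - [0]) \<cdots> (x - [k - 1])\<close>, so that \<open>x ^ n\<close> is the sum of the
  \<open>S n k \<phi> k\<close>, and let \<open>L\<close> be the linear functional with \<open>L (\<phi> k) = a ^ k\<close>. The three-term recurrence gives
  \<open>L (\<phi> k C\<^sub>n) = a ^ k ([k] - [0]) \<cdots> ([k] - [n - 1])\<close>, which vanishes exactly for \<open>k < n\<close>. Hence the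
  \<open>C\<^sub>n\<close> are orthogonal with respect to \<open>L\<close>.

  On the combinatorial side, appending a letter \<open>c\<close> to a word changes its \<open>rs\<close> by an amount that depends
  on the whole word. To get a recursion one imagines that the word is followed by further letters,
  forming a set \<open>R\<close>: removing the last letter \<open>c\<close> then replaces \<open>R\<close> by \<open>R \<union> {c}\<close>. The generating
  function over partitions with \<open>k\<close> blocks depends on \<open>R\<close> only through the factor
  \<open>q ^ (\<Sum>r\<in>R. k - r)\<close>.
\<close>

section \<open>Words: \<open>rs\<close> relative to letters on the right\<close>

text \<open>The letters in \<open>R\<close> are regarded as standing to the right of the word.\<close>

definition rs_rel :: "nat set \<Rightarrow> nat list \<Rightarrow> nat" where
  "rs_rel R w =
    (\<Sum>i<length w. card {j. j < w ! i \<and> (j \<in> R \<or> (\<exists>k. i < k \<and> k < length w \<and> w ! k = j))})"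

lemma rs_word_eq_rs_rel: "rs_word w = rs_rel {} w"
  by (simp add: rs_word_def rs_rel_def)

lemma rs_rel_Nil [simp]: "rs_rel R [] = 0"
  by (simp add: rs_rel_def)

text \<open>The positions of \<open>w\<close> see \<open>c\<close> as one more letter on the right,
  the last position sees only \<open>R\<close>. Values are counted once, so \<open>c\<close> may
  already lie in \<open>R\<close>.\<close>

lemma rs_rel_snoc: "rs_rel R (w @ [c]) = rs_rel (insert c R) w + card {j \<in> R. j < c}"
proof -
  have "(\<exists>k. i < k \<and> k < Suc (length w) \<and> (w @ [c]) ! k = j) \<longleftrightarrow>
      (i < length w \<and> c = j) \<or> (\<exists>k. i < k \<and> k < length w \<and> w ! k = j)" for i j
  proof -
    have "(\<exists>k. i < k \<and> k < Suc (length w) \<and> (w @ [c]) ! k = j) \<longleftrightarrow>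
        (i < length w \<and> (w @ [c]) ! length w = j) \<or> (\<exists>k. i < k \<and> k < length w \<and> (w @ [c]) ! k = j)"
      unfolding less_Suc_eq by blast
    then show ?thesis
      by (simp add: nth_append cong: conj_cong)
  qed
  then have "{j. j < (w @ [c]) ! i \<and> (j \<in> R \<or> (\<exists>k. i < k \<and> k < Suc (length w) \<and> (w @ [c]) ! k = j))}
      = (if i < length w then {j. j < w ! i \<and> (j \<in> insert c R \<or> (\<exists>k. i < k \<and> k < length w \<and> w ! k = j))}
         else {j \<in> R. j < c})" if "i \<le> length w" for i
    using that by (auto simp: nth_append)
  then show ?thesis
    by (simp add: rs_rel_def)
qed

section \<open>q-brackets and q-Stirling numbers\<close>

lemma q_bracket_0 [simp]: "q_bracket q 0 = 0"
  by (simp add: q_bracket_def)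

lemma q_bracket_eq_sum:
  fixes q :: "'a::field"
  assumes "q \<noteq> 1"
  shows "q_bracket q n = (\<Sum>i<n. q ^ i)"
  using assms by (simp add: q_bracket_def sum_gp_strict)

lemma q_bracket_Suc:
  fixes q :: "'a::field"
  assumes "q \<noteq> 1"
  shows "q_bracket q (Suc n) = 1 + q * q_bracket q n"
  using assms by (simp add: q_bracket_def field_simps)

fun q_stirling :: "'a::field \<Rightarrow> nat \<Rightarrow> nat \<Rightarrow> 'a" where
  "q_stirling q 0 k = (if k = 0 then 1 else 0)"
| "q_stirling q (Suc n) 0 = 0"
| "q_stirling q (Suc n) (Suc k) = q_stirling q n k + q_bracket q (Suc k) * q_stirling q n (Suc k)"

lemma q_stirling_eq_0: "n < k \<Longrightarrow> q_stirling q n k = 0"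
  by (induction q n k rule: q_stirling.induct) auto

lemma q_stirling_same [simp]: "q_stirling q n n = 1"
  by (induction n) (auto simp: q_stirling_eq_0)

section \<open>Geometric sums over ranks\<close>

lemma card_less_Suc_split:
  fixes R :: "nat set"
  shows "card {r \<in> R. r < Suc c} = card {r \<in> R. r < c} + (if c \<in> R then 1 else 0)"
proof -
  have "{r \<in> R. r < Suc c} = (if c \<in> R then insert c {r \<in> R. r < c} else {r \<in> R. r < c})"
    by (auto simp: less_Suc_eq)
  then show ?thesis
    by simp
qed

text \<open>In increasing order, the elements of \<open>R\<close> in \<open>{1..k}\<close> have
  ranks 0, 1, 2, and so on; an element 0 of \<open>R\<close> would shift all of them by one.\<close>

lemma sum_power_rank_mem:
  fixes q :: "'a::comm_semiring_1"
  assumes "0 \<notin> R"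
  shows "(\<Sum>c\<in>{1..k} \<inter> R. q ^ card {r \<in> R. r < c}) = (\<Sum>i<card {r \<in> R. r < Suc k}. q ^ i)"
proof (induction k)
  case 0
  have *: "{r \<in> R. r < Suc 0} = {}"
    using assms by auto
  show ?case
    unfolding * by simp
next
  case (Suc k)
  then show ?case
    by (simp add: card_less_Suc_split[of R "Suc k"] atLeastAtMostSuc_conv add.commute)
qed

text \<open>Passing from \<open>k\<close> to \<open>k + 1\<close> raises every old exponent by one.
  The freed lowest exponent is taken by \<open>k + 1\<close> if it lies outside \<open>R\<close>;
  otherwise the lower bound of the interval rises. The inequality is carried along because splitting
  off the lowest exponent requires a nonempty interval.\<close>

lemma sum_power_rank_not_mem:
  fixes q :: "'a::comm_semiring_1"
  assumes "0 \<notin> R"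
  shows "(\<Sum>c\<in>{1..k} - R. q ^ (card {r \<in> R. r < c} + (k - c)))
      = (\<Sum>i\<in>{card {r \<in> R. r < Suc k}..<k}. q ^ i) \<and> card {r \<in> R. r < Suc k} \<le> k"
proof (induction k)
  case 0
  have *: "{r \<in> R. r < Suc 0} = {}"
    using assms by auto
  show ?case
    unfolding * by simp
next
  case (Suc k)
  let ?s = "card {r \<in> R. r < Suc k}"
  have "(\<Sum>c\<in>{1..k} - R. q ^ (card {r \<in> R. r < c} + (Suc k - c)))
      = q * (\<Sum>c\<in>{1..k} - R. q ^ (card {r \<in> R. r < c} + (k - c)))"
    by (auto simp: sum_distrib_left Suc_diff_le intro!: sum.cong)
  also have "\<dots> = (\<Sum>i\<in>{Suc ?s..<Suc k}. q ^ i)"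
    using Suc by (simp add: sum_distrib_left sum.shift_bounds_Suc_ivl del: sum.op_ivl_Suc)
  finally have *: "(\<Sum>c\<in>{1..k} - R. q ^ (card {r \<in> R. r < c} + (Suc k - c))) = \<dots>" .
  show ?case
  proof (cases "Suc k \<in> R")
    case True
    then have "{1..Suc k} - R = {1..k} - R"
      by (auto simp: le_Suc_eq)
    then show ?thesis
      using * True Suc by (simp add: card_less_Suc_split[of R "Suc k"])
  next
    case False
    then have "{1..Suc k} - R = insert (Suc k) ({1..k} - R)"
      by (auto simp: le_Suc_eq)
    moreover have "(\<Sum>i\<in>{?s..<Suc k}. q ^ i) = q ^ ?s + (\<Sum>i\<in>{Suc ?s..<Suc k}. q ^ i)"
      using Suc by (intro sum.atLeast_Suc_lessThan) auto
    ultimately show ?thesis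
      using * False Suc by (simp add: card_less_Suc_split[of R "Suc k"] del: sum.op_ivl_Suc)
  qed
qed

text \<open>The exponents run through \<open>0, \<dots>, k - 1\<close>: the letters in \<open>R\<close> give the smallest ones in increasing
  order, the others give the remaining ones in decreasing order.\<close>

lemma sum_power_rank:
  fixes q :: "'a::comm_semiring_1"
  assumes "0 \<notin> R"
  shows "(\<Sum>c\<in>{1..k}. q ^ (card {r \<in> R. r < c} + (if c \<in> R then 0 else k - c))) = (\<Sum>i<k. q ^ i)"
proof -
  let ?f = "\<lambda>c. q ^ (card {r \<in> R. r < c} + (if c \<in> R then 0 else k - c))"
  let ?s = "card {r \<in> R. r < Suc k}"
  have "(\<Sum>c\<in>{1..k}. ?f c) = (\<Sum>c\<in>{1..k} \<inter> R. ?f c) + (\<Sum>c\<in>{1..k} - R. ?f c)"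
    by (rule sum.Int_Diff) simp
  also have "(\<Sum>c\<in>{1..k} \<inter> R. ?f c) = (\<Sum>i<?s. q ^ i)"
    using sum_power_rank_mem[OF assms, of q k] by simp
  also have "(\<Sum>c\<in>{1..k} - R. ?f c) = (\<Sum>i\<in>{?s..<k}. q ^ i)"
    using sum_power_rank_not_mem[OF assms, of q k] by simp
  also have "(\<Sum>i<?s. q ^ i) + \<dots> = (\<Sum>i<k. q ^ i)"
    using sum_power_rank_not_mem[OF assms, of q k]
    by (simp add: lessThan_atLeast0 sum.atLeastLessThan_concat)
  finally show ?thesis .
qed

section \<open>Set partitions: inserting and removing the largest element\<close>

text \<open>With \<open>B = {}\<close> this adds the singleton block of \<open>x\<close>.\<close>

definition add_to_block :: "nat \<Rightarrow> nat set set \<Rightarrow> nat set \<Rightarrow> nat set set" where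
  "add_to_block x \<pi> B = insert (insert x B) (\<pi> - {B})"

lemma finite_set_partitions [simp]: "finite (set_partitions n)"
  unfolding set_partitions_def
  by (rule finite_subset[of _ "Pow (Pow {1..n})"]) (auto dest: partition_onD1)

lemma set_partitionsD:
  assumes "\<pi> \<in> set_partitions n"
  shows "partition_on {1..n} \<pi>" "finite \<pi>" "\<And>B. B \<in> \<pi> \<Longrightarrow> finite B \<and> B \<noteq> {} \<and> B \<subseteq> {1..n}"
proof -
  show *: "partition_on {1..n} \<pi>"
    using assms by (simp add: set_partitions_def)
  show "finite \<pi>"
    using * finite_elements by blast
  show "finite B \<and> B \<noteq> {} \<and> B \<subseteq> {1..n}" if "B \<in> \<pi>" for B
    using * that by (auto simp: partition_on_def intro: finite_subset)
qed

lemma block_eqI: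
  assumes "partition_on A \<pi>" "B \<in> \<pi>" "C \<in> \<pi>" "x \<in> B" "x \<in> C"
  shows "B = C"
  using assms by (meson disjointD disjoint_iff partition_onD2)

lemma block_of_eqI:
  assumes "partition_on A \<pi>" "B \<in> \<pi>" "x \<in> B"
  shows "block_of \<pi> x = B"
  unfolding block_of_def
  using assms block_eqI[OF assms(1)] by (intro the_equality) auto

lemma block_of_mem:
  assumes "partition_on A \<pi>" "x \<in> A"
  shows "block_of \<pi> x \<in> \<pi>" "x \<in> block_of \<pi> x"
proof -
  obtain B where "B \<in> \<pi>" "x \<in> B"
    using assms by (auto simp: partition_on_def)
  then show "block_of \<pi> x \<in> \<pi>" "x \<in> block_of \<pi> x"
    using block_of_eqI[OF assms(1)] by auto
qed

lemma partition_on_insert_block: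
  assumes "partition_on A \<pi>" "x \<notin> A" "B \<in> insert {} \<pi>"
  shows "partition_on (insert x A) (insert (insert x B) (\<pi> - {B}))"
proof (rule partition_onI)
  show "\<Union>(insert (insert x B) (\<pi> - {B})) = insert x A"
    using assms by (auto simp: partition_on_def)
  show "{} \<notin> insert (insert x B) (\<pi> - {B})"
    using assms by (auto simp: partition_on_def)
  have x: "x \<notin> C" if "C \<in> \<pi>" for C
    using assms that by (auto simp: partition_on_def)
  have d: "disjnt C D" if "C \<in> \<pi>" "D \<in> \<pi>" "C \<noteq> D" for C D
    using assms that by (auto simp: partition_on_def disjoint_def disjnt_def)
  show "disjnt C D" if "C \<in> insert (insert x B) (\<pi> - {B})" "D \<in> insert (insert x B) (\<pi> - {B})" "C \<noteq> D"
    for C D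
    using that d[of C D] d[of B D] d[of C B] x assms(3) by (auto simp: disjnt_def)
qed

text \<open>Deleting \<open>{{}}\<close> covers the case that \<open>x\<close> is a singleton
  block.\<close>

lemma partition_on_remove_element:
  assumes "partition_on (insert x A) \<pi>" "x \<notin> A" "B \<in> \<pi>" "x \<in> B"
  shows "partition_on A (insert (B - {x}) (\<pi> - {B}) - {{}})"
proof (rule partition_onI)
  have d: "C \<inter> D = {}" if "C \<in> \<pi>" "D \<in> \<pi>" "C \<noteq> D" for C D
    using assms that by (auto simp: partition_on_def disjoint_def)
  have U: "\<Union>\<pi> = insert x A"
    using assms by (simp add: partition_on_def)
  have "\<Union>(insert (B - {x}) (\<pi> - {B}) - {{}}) = \<Union>\<pi> - {x}"
    using d[OF assms(3)] assms(3,4) by auto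
  then show "\<Union>(insert (B - {x}) (\<pi> - {B}) - {{}}) = A"
    using U assms(2) by auto
  show "disjnt C D" if CD: "C \<in> insert (B - {x}) (\<pi> - {B}) - {{}}" "D \<in> insert (B - {x}) (\<pi> - {B}) - {{}}" "C \<noteq> D"
    for C D
  proof -
    consider "C \<in> \<pi>" "D \<in> \<pi>" | "C = B - {x}" "D \<in> \<pi>" "B \<noteq> D" | "C \<in> \<pi>" "D = B - {x}" "C \<noteq> B"
      using CD by blast
    then show ?thesis
    proof cases
      case 1
      then show ?thesis
        using d[of C D] \<open>C \<noteq> D\<close> by (simp add: disjnt_def)
    next
      case 2
      then show ?thesis
        using d[OF assms(3), of D] by (auto simp: disjnt_def)
    next
      case 3
      then show ?thesis
        using d[OF _ assms(3), of C] by (auto simp: disjnt_def)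
    qed
  qed
qed simp

text \<open>Deleting \<open>Suc n\<close> from its block undoes the insertion. A singleton block
  disappears, which the second component \<open>{}\<close> records.\<close>

lemma bij_betw_add_to_block:
  "bij_betw (\<lambda>(\<pi>, B). add_to_block (Suc n) \<pi> B)
     (SIGMA \<pi>:set_partitions n. insert {} \<pi>) (set_partitions (Suc n))"
proof (rule bij_betw_byWitness[where f' = "\<lambda>\<pi>. let B = block_of \<pi> (Suc n) in
    (insert (B - {Suc n}) (\<pi> - {B}) - {{}}, B - {Suc n})"])
  have ins: "{1..Suc n} = insert (Suc n) {1..n}"
    by auto
  let ?S = "SIGMA \<pi>:set_partitions n. insert {} \<pi>"
  have part: "partition_on {1..Suc n} (add_to_block (Suc n) \<pi> B)" if "(\<pi>, B) \<in> ?S" for \<pi> B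
    using that unfolding add_to_block_def ins
    by (intro partition_on_insert_block) (auto simp: set_partitions_def)
  have blk: "block_of (add_to_block (Suc n) \<pi> B) (Suc n) = insert (Suc n) B" if "(\<pi>, B) \<in> ?S" for \<pi> B
    using part[OF that] by (rule block_of_eqI) (auto simp: add_to_block_def)
  show "\<forall>p\<in>?S. (let B = block_of (case p of (\<pi>, B) \<Rightarrow> add_to_block (Suc n) \<pi> B) (Suc n) in
      (insert (B - {Suc n}) ((case p of (\<pi>, B) \<Rightarrow> add_to_block (Suc n) \<pi> B) - {B}) - {{}}, B - {Suc n})) = p"
  proof (clarify)
    fix \<pi> B
    assume S: "\<pi> \<in> set_partitions n" "B \<in> insert {} \<pi>"
    have no: "Suc n \<notin> C" if "C \<in> insert {} \<pi>" for C
      using set_partitionsD(3)[OF S(1), of C] that by fastforce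
    then have "insert (Suc n) B \<notin> \<pi>"
      by blast
    moreover have "B - {Suc n} = B" "{} \<notin> \<pi>"
      using no[OF S(2)] set_partitionsD(3)[OF S(1)] by auto
    moreover have "add_to_block (Suc n) \<pi> B - {insert (Suc n) B} = \<pi> - {B}"
      using \<open>insert (Suc n) B \<notin> \<pi>\<close> by (auto simp: add_to_block_def)
    moreover have "insert B (\<pi> - {B}) - {{}} = \<pi>"
      using S(2) \<open>{} \<notin> \<pi>\<close> by auto
    ultimately show "(let C = block_of (add_to_block (Suc n) \<pi> B) (Suc n) in
      (insert (C - {Suc n}) (add_to_block (Suc n) \<pi> B - {C}) - {{}}, C - {Suc n})) = (\<pi>, B)"
      using S blk[of \<pi> B] by (simp add: Let_def)
  qed
  show "\<forall>\<pi>\<in>set_partitions (Suc n). (case (let B = block_of \<pi> (Suc n) in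
      (insert (B - {Suc n}) (\<pi> - {B}) - {{}}, B - {Suc n})) of (\<pi>, B) \<Rightarrow> add_to_block (Suc n) \<pi> B) = \<pi>"
  proof
    fix \<pi>
    assume "\<pi> \<in> set_partitions (Suc n)"
    then have p: "partition_on {1..Suc n} \<pi>"
      by (rule set_partitionsD)
    define B where "B = block_of \<pi> (Suc n)"
    have B: "B \<in> \<pi>" "Suc n \<in> B"
      using block_of_mem[OF p, of "Suc n"] by (auto simp: B_def)
    have "{} \<notin> \<pi>"
      using p by (auto simp: partition_on_def)
    \<comment> \<open>Otherwise \<open>add_to_block\<close>, which removes
      \<open>B - {Suc n}\<close>, would also delete a genuine block of \<open>\<pi>\<close>.\<close>
    have "B - {Suc n} \<notin> \<pi>"
    proof
      assume *: "B - {Suc n} \<in> \<pi>"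
      with \<open>{} \<notin> \<pi>\<close> obtain x where "x \<in> B - {Suc n}"
        by (metis all_not_in_conv)
      then show False
        using block_eqI[OF p B(1) *, of x] B(2) by auto
    qed
    with \<open>{} \<notin> \<pi>\<close> have *: "insert (B - {Suc n}) (\<pi> - {B}) - {{}} - {B - {Suc n}} = \<pi> - {B}"
      by blast
    have "add_to_block (Suc n) (insert (B - {Suc n}) (\<pi> - {B}) - {{}}) (B - {Suc n}) = \<pi>"
      unfolding add_to_block_def * by (simp add: B insert_absorb insert_Diff[OF B(1)])
    then show "(case (let B = block_of \<pi> (Suc n) in
      (insert (B - {Suc n}) (\<pi> - {B}) - {{}}, B - {Suc n})) of (\<pi>, B) \<Rightarrow> add_to_block (Suc n) \<pi> B) = \<pi>"
      by (simp add: Let_def flip: B_def)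
  qed
  show "(\<lambda>(\<pi>, B). add_to_block (Suc n) \<pi> B) ` ?S \<subseteq> set_partitions (Suc n)"
    using part by (auto simp: set_partitions_def)
  show "(\<lambda>\<pi>. let B = block_of \<pi> (Suc n) in
    (insert (B - {Suc n}) (\<pi> - {B}) - {{}}, B - {Suc n})) ` set_partitions (Suc n) \<subseteq> ?S"
  proof (rule image_subsetI)
    fix \<pi>
    assume "\<pi> \<in> set_partitions (Suc n)"
    then have p: "partition_on (insert (Suc n) {1..n}) \<pi>"
      unfolding set_partitions_def ins by simp
    define B where "B = block_of \<pi> (Suc n)"
    have "insert (B - {Suc n}) (\<pi> - {B}) - {{}} \<in> set_partitions n"
      unfolding set_partitions_def B_def
      using partition_on_remove_element[OF p _ block_of_mem[OF p]] by simp
    then show "(let B = block_of \<pi> (Suc n) in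
        (insert (B - {Suc n}) (\<pi> - {B}) - {{}}, B - {Suc n})) \<in> ?S"
      by (simp add: Let_def flip: B_def)
  qed
qed

section \<open>Restricted growth functions\<close>

text \<open>Disjoint nonempty blocks have distinct minima, and a block is numbered by the rank of
  its minimum. Injectivity and counting give surjectivity.\<close>

lemma bij_betw_block_number:
  assumes "\<pi> \<in> set_partitions n"
  shows "bij_betw (block_number \<pi>) \<pi> {1..card \<pi>}"
proof -
  note D = set_partitionsD[OF assms]
  have lt: "block_number \<pi> B < block_number \<pi> C" if "B \<in> \<pi>" "C \<in> \<pi>" "Min B < Min C" for B C
  proof -
    have "C \<in> {X \<in> \<pi>. Min X \<le> Min C} - {X \<in> \<pi>. Min X \<le> Min B}"
      using that by auto
    moreover have "{X \<in> \<pi>. Min X \<le> Min B} \<subseteq> {X \<in> \<pi>. Min X \<le> Min C}"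
      using that by auto
    ultimately have "{X \<in> \<pi>. Min X \<le> Min B} \<subset> {X \<in> \<pi>. Min X \<le> Min C}"
      by blast
    then show ?thesis
      unfolding block_number_def using D(2) by (intro psubset_card_mono) auto
  qed
  have "inj_on (block_number \<pi>) \<pi>"
  proof (rule inj_onI)
    fix B C
    assume BC: "B \<in> \<pi>" "C \<in> \<pi>" "block_number \<pi> B = block_number \<pi> C"
    then have "Min B = Min C"
      using lt[of B C] lt[of C B] by (metis less_irrefl linorder_neqE_nat)
    then show "B = C"
      using BC D block_eqI[OF D(1), of B C "Min B"] Min_in by metis
  qed
  moreover have "block_number \<pi> ` \<pi> \<subseteq> {1..card \<pi>}"
  proof (clarify)
    fix B
    assume "B \<in> \<pi>"
    then have "card {B} \<le> block_number \<pi> B"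
      unfolding block_number_def using D(2) by (intro card_mono) auto
    moreover have "block_number \<pi> B \<le> card \<pi>"
      unfolding block_number_def using D(2) by (intro card_mono) auto
    ultimately show "block_number \<pi> B \<in> {1..card \<pi>}"
      by simp
  qed
  ultimately show ?thesis
    by (simp add: bij_betw_def card_image card_subset_eq)
qed

text \<open>Since \<open>Suc n\<close> exceeds all old elements, it changes neither the minimum of
  its block nor the order of the blocks.\<close>

lemma rgf_add_to_block:
  assumes "\<pi> \<in> set_partitions n" "B \<in> \<pi>"
  shows "rgf (Suc n) (add_to_block (Suc n) \<pi> B) = rgf n \<pi> @ [block_number \<pi> B]"
    and "card (add_to_block (Suc n) \<pi> B) = card \<pi>"
proof -
  note D = set_partitionsD[OF assms(1)]
  define f where "f = (\<lambda>C. if C = B then insert (Suc n) B else C)"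
  let ?\<pi> = "add_to_block (Suc n) \<pi> B"
  have no: "Suc n \<notin> C" if "C \<in> \<pi>" for C
    using D(3)[OF that] by auto
  have im: "?\<pi> = f ` \<pi>"
    using assms(2) by (auto simp: add_to_block_def f_def)
  have inj: "inj_on f \<pi>"
    using no by (auto simp: inj_on_def f_def)
  show "card ?\<pi> = card \<pi>"
    unfolding im using inj by (rule card_image)
  have Min: "Min (f C) = Min C" if "C \<in> \<pi>" for C
  proof -
    have "Min B \<le> Suc n"
      using D(3)[OF assms(2)] Min_in[of B] by fastforce
    moreover have "Min (insert (Suc n) B) = min (Suc n) (Min B)"
      using D(3)[OF assms(2)] by simp
    ultimately show ?thesis
      by (simp add: f_def)
  qed
  have num: "block_number ?\<pi> (f C) = block_number \<pi> C" if "C \<in> \<pi>" for C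
  proof -
    have "{X \<in> ?\<pi>. Min X \<le> Min (f C)} = f ` {X \<in> \<pi>. Min X \<le> Min C}"
      using Min that by (auto simp: im)
    then show ?thesis
      using inj unfolding block_number_def
      by (metis (no_types, lifting) card_image inj_on_subset mem_Collect_eq subsetI)
  qed
  have "(\<pi>, B) \<in> (SIGMA \<pi>:set_partitions n. insert {} \<pi>)"
    using assms by auto
  then have "?\<pi> \<in> set_partitions (Suc n)"
    using bij_betw_apply[OF bij_betw_add_to_block] by fastforce
  then have p: "partition_on {1..Suc n} ?\<pi>"
    by (rule set_partitionsD)
  have "block_of ?\<pi> (Suc n) = f B"
    using p by (rule block_of_eqI) (auto simp: im f_def assms)
  moreover have "block_of ?\<pi> i = f (block_of \<pi> i)" if "i \<in> {1..n}" for i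
    using p block_of_mem[OF D(1) that] by (intro block_of_eqI[OF p]) (auto simp: im f_def)
  ultimately show "rgf (Suc n) ?\<pi> = rgf n \<pi> @ [block_number \<pi> B]"
    using num assms(2) block_of_mem[OF D(1)] by (auto simp: rgf_def)
qed

text \<open>The new block has the largest minimum, so it comes last.\<close>

lemma rgf_add_singleton:
  assumes "\<pi> \<in> set_partitions n"
  shows "rgf (Suc n) (add_to_block (Suc n) \<pi> {}) = rgf n \<pi> @ [Suc (card \<pi>)]"
    and "card (add_to_block (Suc n) \<pi> {}) = Suc (card \<pi>)"
proof -
  note D = set_partitionsD[OF assms(1)]
  let ?\<pi> = "add_to_block (Suc n) \<pi> {}"
  have "{} \<notin> \<pi>" "{Suc n} \<notin> \<pi>"
    using D(3) by force+
  then have eq: "?\<pi> = insert {Suc n} \<pi>"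
    by (simp add: add_to_block_def)
  show card: "card ?\<pi> = Suc (card \<pi>)"
    using D(2) \<open>{Suc n} \<notin> \<pi>\<close> by (simp add: eq)
  have Min: "Min C < Suc n" if "C \<in> \<pi>" for C
    using D(3)[OF that] Min_in[of C] by fastforce
  have num: "block_number ?\<pi> C = block_number \<pi> C" if "C \<in> \<pi>" for C
    unfolding block_number_def eq using Min[OF that] by (intro arg_cong[where f = card]) auto
  have "{X \<in> ?\<pi>. Min X \<le> Min {Suc n}} = ?\<pi>"
    using Min by (auto simp: eq less_imp_le)
  then have numS: "block_number ?\<pi> {Suc n} = Suc (card \<pi>)"
    unfolding block_number_def using card by simp
  have "(\<pi>, {}) \<in> (SIGMA \<pi>:set_partitions n. insert {} \<pi>)"
    using assms by auto
  then have "?\<pi> \<in> set_partitions (Suc n)"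
    using bij_betw_apply[OF bij_betw_add_to_block] by fastforce
  then have p: "partition_on {1..Suc n} ?\<pi>"
    by (rule set_partitionsD)
  have "block_of ?\<pi> (Suc n) = {Suc n}"
    using p by (rule block_of_eqI) (auto simp: eq)
  moreover have "block_of ?\<pi> i = block_of \<pi> i" if "i \<in> {1..n}" for i
    using block_of_mem[OF D(1) that] by (intro block_of_eqI[OF p]) (auto simp: eq)
  ultimately show "rgf (Suc n) ?\<pi> = rgf n \<pi> @ [Suc (card \<pi>)]"
    using num numS block_of_mem[OF D(1)] by (auto simp: rgf_def)
qed

text \<open>\<open>F\<close> sees only the number of blocks and the word, so choosing a block for
  \<open>Suc n\<close> amounts to choosing the last letter.\<close>

lemma sum_set_partitions_Suc:
  fixes F :: "nat \<Rightarrow> nat list \<Rightarrow> 'a::comm_monoid_add"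
  shows "(\<Sum>\<pi>\<in>set_partitions (Suc n). F (card \<pi>) (rgf (Suc n) \<pi>)) =
    (\<Sum>\<pi>\<in>set_partitions n. F (Suc (card \<pi>)) (rgf n \<pi> @ [Suc (card \<pi>)]) +
      (\<Sum>c\<in>{1..card \<pi>}. F (card \<pi>) (rgf n \<pi> @ [c])))"
proof -
  let ?G = "\<lambda>\<pi>. F (card \<pi>) (rgf (Suc n) \<pi>)"
  have "(\<Sum>\<pi>\<in>set_partitions (Suc n). ?G \<pi>) =
    (\<Sum>p\<in>(SIGMA \<pi>:set_partitions n. insert {} \<pi>). ?G (case p of (\<pi>, B) \<Rightarrow> add_to_block (Suc n) \<pi> B))"
    by (rule sum.reindex_bij_betw[OF bij_betw_add_to_block, symmetric])
  also have "\<dots> = (\<Sum>\<pi>\<in>set_partitions n. \<Sum>B\<in>insert {} \<pi>. ?G (add_to_block (Suc n) \<pi> B))"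
    by (subst sum.Sigma) (auto simp: set_partitionsD intro!: sum.cong)
  also have "\<dots> = (\<Sum>\<pi>\<in>set_partitions n. F (Suc (card \<pi>)) (rgf n \<pi> @ [Suc (card \<pi>)]) +
      (\<Sum>c\<in>{1..card \<pi>}. F (card \<pi>) (rgf n \<pi> @ [c])))"
  proof (rule sum.cong[OF refl])
    fix \<pi>
    assume \<pi>: "\<pi> \<in> set_partitions n"
    have "{} \<notin> \<pi>"
      using set_partitionsD(3)[OF \<pi>] by blast
    moreover have "(\<Sum>B\<in>\<pi>. ?G (add_to_block (Suc n) \<pi> B)) =
        (\<Sum>B\<in>\<pi>. F (card \<pi>) (rgf n \<pi> @ [block_number \<pi> B]))"
      using \<pi> by (intro sum.cong) (simp_all add: rgf_add_to_block)
    moreover have "\<dots> = (\<Sum>c\<in>{1..card \<pi>}. F (card \<pi>) (rgf n \<pi> @ [c]))"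
      by (rule sum.reindex_bij_betw[OF bij_betw_block_number[OF \<pi>]])
    ultimately show "(\<Sum>B\<in>insert {} \<pi>. ?G (add_to_block (Suc n) \<pi> B)) =
      F (Suc (card \<pi>)) (rgf n \<pi> @ [Suc (card \<pi>)]) + (\<Sum>c\<in>{1..card \<pi>}. F (card \<pi>) (rgf n \<pi> @ [c]))"
      using \<pi> by (simp add: set_partitionsD rgf_add_singleton)
  qed
  finally show ?thesis .
qed

section \<open>Generating function of \<open>rs\<close> by number of blocks\<close>

text \<open>The subtraction \<open>k - r\<close> is truncated, so that elements of \<open>R\<close> beyond \<open>k\<close> do not count.\<close>

lemma sum_power_rs_rel_rgf:
  fixes q :: "'a::field"
  assumes "q \<noteq> 1" "finite R" "0 \<notin> R"
  shows "(\<Sum>\<pi>\<in>set_partitions n. if card \<pi> = k then q ^ rs_rel R (rgf n \<pi>) else 0) =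
    q ^ (\<Sum>r\<in>R. k - r) * q_stirling q n k"
  using assms(2,3)
proof (induction n arbitrary: k R)
  case 0
  have "set_partitions 0 = {{}}"
    by (auto simp: set_partitions_def partition_on_empty)
  then show ?case
    by (simp add: rgf_def)
next
  case (Suc n)
  let ?w = "\<lambda>R k \<pi>. if card \<pi> = k then q ^ rs_rel R (rgf n \<pi>) else 0"
  let ?d = "\<lambda>c. card {r \<in> R. r < c}"
  let ?e = "\<Sum>r\<in>R. k - r"
  let ?new = "\<Sum>\<pi>\<in>set_partitions n. if Suc (card \<pi>) = k
      then q ^ rs_rel R (rgf n \<pi> @ [Suc (card \<pi>)]) else 0"
  let ?old = "\<Sum>\<pi>\<in>set_partitions n. \<Sum>c\<in>{1..card \<pi>}. if card \<pi> = k
      then q ^ rs_rel R (rgf n \<pi> @ [c]) else 0"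
  have "(\<Sum>\<pi>\<in>set_partitions (Suc n). if card \<pi> = k then q ^ rs_rel R (rgf (Suc n) \<pi>) else 0)
      = ?new + ?old"
    by (subst sum_set_partitions_Suc[where F = "\<lambda>m w. if m = k then q ^ rs_rel R w else 0"])
      (rule sum.distrib)
  \<comment> \<open>An old last letter \<open>c\<close> contributes its rank in \<open>R\<close>
    directly and, through the induction hypothesis for \<open>insert c R\<close>, another
    \<open>k - c\<close> if it is not in \<open>R\<close>. Summing over \<open>c\<close> gives
    \<open>[k]\<close> whatever \<open>R\<close> is.\<close>
  moreover have "?old = q ^ ?e * q_bracket q k * q_stirling q n k"
  proof -
    have exponent: "(\<Sum>r\<in>insert c R. k - r) = ?e + (if c \<in> R then 0 else k - c)" for c
      using Suc.prems by (simp add: insert_absorb add.commute)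
    have "?old = (\<Sum>\<pi>\<in>set_partitions n. \<Sum>c\<in>{1..k}. q ^ ?d c * ?w (insert c R) k \<pi>)"
    proof (rule sum.cong[OF refl])
      fix \<pi>
      show "(\<Sum>c\<in>{1..card \<pi>}. if card \<pi> = k then q ^ rs_rel R (rgf n \<pi> @ [c]) else 0) =
          (\<Sum>c\<in>{1..k}. q ^ ?d c * ?w (insert c R) k \<pi>)"
        by (cases "card \<pi> = k") (simp_all add: rs_rel_snoc power_add mult.commute)
    qed
    also have "\<dots> = (\<Sum>c\<in>{1..k}. q ^ ?d c * (\<Sum>\<pi>\<in>set_partitions n. ?w (insert c R) k \<pi>))"
      by (subst sum.swap) (simp only: sum_distrib_left)
    also have "\<dots> = (\<Sum>c\<in>{1..k}. q ^ ?d c * (q ^ (\<Sum>r\<in>insert c R. k - r) * q_stirling q n k))"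
      using Suc by (intro sum.cong refl) simp
    also have "\<dots> = q ^ ?e * (\<Sum>c\<in>{1..k}. q ^ (?d c + (if c \<in> R then 0 else k - c))) * q_stirling q n k"
      unfolding exponent power_add sum_distrib_left sum_distrib_right
      by (intro sum.cong refl) (simp only: mult_ac)
    finally show ?thesis
      unfolding sum_power_rank[OF Suc.prems(2)] q_bracket_eq_sum[OF assms(1)] .
  qed
  moreover have "?new = q ^ ?e * (case k of 0 \<Rightarrow> 0 | Suc m \<Rightarrow> q_stirling q n m)"
  proof (cases k)
    case 0
    then show ?thesis
      by simp
  next
    case (Suc m)
    \<comment> \<open>Lowering \<open>k\<close> to \<open>m\<close> costs one for each
      \<open>r < k\<close> in \<open>R\<close>, which \<open>?d k\<close> makes up for;
      \<open>k\<close> itself contributes \<open>m - k = 0\<close> by truncation.\<close>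
    have "?d k + (\<Sum>r\<in>insert k R. m - r) = ?e"
    proof -
      have "?d k = (\<Sum>r\<in>R. if r < k then 1 else 0)"
        using Suc.prems by (simp add: sum.If_cases Int_def)
      moreover have "(\<Sum>r\<in>insert k R. m - r) = (\<Sum>r\<in>R. m - r)"
        using Suc.prems \<open>k = Suc m\<close> by (simp add: sum.insert_if)
      ultimately show ?thesis
        using \<open>k = Suc m\<close> by (auto simp: simp flip: sum.distrib intro!: sum.cong)
    qed
    then have "q ^ ?e = q ^ ?d k * q ^ (\<Sum>r\<in>insert k R. m - r)"
      by (simp only: power_add[symmetric])
    moreover have "?new = q ^ ?d k * (\<Sum>\<pi>\<in>set_partitions n. ?w (insert k R) m \<pi>)"
      unfolding sum_distrib_left using \<open>k = Suc m\<close>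
      by (intro sum.cong refl) (simp add: rs_rel_snoc power_add)
    moreover have "(\<Sum>\<pi>\<in>set_partitions n. ?w (insert k R) m \<pi>) =
        q ^ (\<Sum>r\<in>insert k R. m - r) * q_stirling q n m"
      using Suc.prems \<open>k = Suc m\<close> by (intro Suc.IH) simp_all
    ultimately show ?thesis
      unfolding \<open>k = Suc m\<close> by (simp only: mult.assoc nat.case)
  qed
  moreover have "q_stirling q (Suc n) k =
      (case k of 0 \<Rightarrow> 0 | Suc m \<Rightarrow> q_stirling q n m) + q_bracket q k * q_stirling q n k"
    by (cases k) simp_all
  ultimately show ?case
    by (simp only: distrib_left mult.assoc)
qed

lemma card_le_of_set_partitions:
  assumes "\<pi> \<in> set_partitions n"
  shows "card \<pi> \<le> n"
proof -
  note D = set_partitionsD[OF assms]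
  have "inj_on Min \<pi>"
    using D block_eqI[OF D(1)] Min_in by (metis inj_onI)
  moreover have "Min ` \<pi> \<subseteq> {1..n}"
    using D(3) Min_in by blast
  ultimately show ?thesis
    using card_inj_on_le[of Min \<pi> "{1..n}"] by simp
qed

text \<open>With \<open>R = {}\<close> the prefactor is 1; it remains to group the partitions by
  their number of blocks, which is at most \<open>n\<close>.\<close>

lemma sum_set_partitions_rs:
  fixes a q :: "'a::field"
  assumes "q \<noteq> 1"
  shows "(\<Sum>\<pi>\<in>set_partitions n. a ^ card \<pi> * q ^ rs n \<pi>) = (\<Sum>k\<le>n. q_stirling q n k * a ^ k)"
proof -
  have "q_stirling q n k * a ^ k =
      (\<Sum>\<pi>\<in>set_partitions n. if card \<pi> = k then a ^ card \<pi> * q ^ rs n \<pi> else 0)" for k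
  proof -
    have "q_stirling q n k = (\<Sum>\<pi>\<in>set_partitions n. if card \<pi> = k then q ^ rs n \<pi> else 0)"
      using sum_power_rs_rel_rgf[OF assms, of "{}" k n] unfolding rs_def rs_word_eq_rs_rel by simp
    then show ?thesis
      by (auto simp: sum_distrib_right intro!: sum.cong)
  qed
  then have "(\<Sum>k\<le>n. q_stirling q n k * a ^ k) =
      (\<Sum>k\<le>n. \<Sum>\<pi>\<in>set_partitions n. if card \<pi> = k then a ^ card \<pi> * q ^ rs n \<pi> else 0)"
    by simp
  also have "\<dots> = (\<Sum>\<pi>\<in>set_partitions n. a ^ card \<pi> * q ^ rs n \<pi>)"
    by (subst sum.swap) (auto intro!: sum.cong simp: card_le_of_set_partitions)
  finally show ?thesis ..
qed

section \<open>Linear functionals on polynomials\<close>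

text \<open>Subtracting a multiple of the \<open>p i\<close> of equal degree lowers the degree. The
  rule serves \<open>q_falling\<close> for orthogonality and \<open>q_charlier\<close> for
  uniqueness.\<close>

lemma monic_family_induct [consumes 1, case_names degree lead_coeff add smult base]:
  fixes p :: "nat \<Rightarrow> 'a::field poly"
  assumes "degree f < N"
    and deg: "\<And>i. degree (p i) = i"
    and lc: "\<And>i. lead_coeff (p i) = 1"
    and add: "\<And>f g. Q f \<Longrightarrow> Q g \<Longrightarrow> Q (f + g)"
    and smult: "\<And>c f. Q f \<Longrightarrow> Q (smult c f)"
    and base: "\<And>i. i < N \<Longrightarrow> Q (p i)"
  shows "Q f"
  using assms(1)
proof (induction "degree f" arbitrary: f rule: less_induct)
  case less
  let ?d = "degree f"
  define g where "g = f - smult (lead_coeff f) (p ?d)"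
  have "coeff g ?d = 0" "degree g \<le> ?d"
    using lc[of ?d] deg[of ?d]
    by (auto simp: g_def intro!: degree_diff_le order.trans[OF degree_smult_le])
  then have "g = 0 \<or> degree g < ?d"
    by (metis eq_zero_or_degree_less)
  \<comment> \<open>For constant \<open>f\<close> the remainder is 0 and its degree does not drop,
    so 0 is settled separately.\<close>
  moreover have "Q 0"
    using smult[OF base[of ?d], of 0] less.prems by simp
  ultimately have "Q g"
    using less by auto
  then have "Q (g + smult (lead_coeff f) (p ?d))"
    using add smult base less.prems by blast
  then show ?case
    by (simp add: g_def)
qed

lemma linear_smultD:
  fixes L :: "'a::field poly \<Rightarrow> 'a"
  assumes "Vector_Spaces.linear smult (*) L"
  shows "L (f + g) = L f + L g" "L (smult c f) = c * L f" "L (f - g) = L f - L g" "L 0 = 0"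
proof -
  interpret Vector_Spaces.linear smult "(*)" L
    by (rule assms)
  show "L (f + g) = L f + L g" "L (smult c f) = c * L f" "L (f - g) = L f - L g" "L 0 = 0"
    by (rule add scale diff zero)+
qed

definition moment_functional :: "(nat \<Rightarrow> 'a) \<Rightarrow> 'a::field poly \<Rightarrow> 'a" where
  "moment_functional \<mu> f = (\<Sum>i\<le>degree f. coeff f i * \<mu> i)"

lemma moment_functional_eq:
  assumes "degree f \<le> N"
  shows "moment_functional \<mu> f = (\<Sum>i\<le>N. coeff f i * \<mu> i)"
  unfolding moment_functional_def using assms
  by (intro sum.mono_neutral_left) (auto simp: coeff_eq_0)

lemma linear_moment_functional:
  fixes \<mu> :: "nat \<Rightarrow> 'a::field"
  shows "Vector_Spaces.linear smult (*) (moment_functional \<mu>)"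
proof unfold_locales
  fix f g :: "'a poly" and c :: 'a
  have "degree (f + g) \<le> max (degree f) (degree g)"
    by (rule degree_add_le_max)
  then show "moment_functional \<mu> (f + g) = moment_functional \<mu> f + moment_functional \<mu> g"
    by (simp add: moment_functional_eq[where N = "max (degree f) (degree g)"] sum.distrib algebra_simps)
  have "degree (smult c f) \<le> degree f"
    by (rule degree_smult_le)
  then show "moment_functional \<mu> (smult c f) = c * moment_functional \<mu> f"
    by (simp add: moment_functional_eq[where N = "degree f"] sum_distrib_left algebra_simps)
qed (simp_all add: algebra_simps smult_add_right smult_add_left)

lemma moment_functional_power:
  fixes \<mu> :: "nat \<Rightarrow> 'a::field"
  shows "moment_functional \<mu> ([:0, 1:] ^ n) = \<mu> n"
proof -
  have "moment_functional \<mu> (monom 1 n) = (\<Sum>i\<le>n. if i = n then \<mu> n else 0)"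
    by (simp add: moment_functional_def degree_monom_eq if_distrib[of "\<lambda>x. x * _"] cong: if_cong)
  then show ?thesis
    by (simp add: monom_altdef)
qed

section \<open>Two monic bases and the candidate functional\<close>

text \<open>This is the \<open>\<phi> k\<close> above, a q-analogue of the falling
  factorial.\<close>

definition q_falling :: "'a::field \<Rightarrow> nat \<Rightarrow> 'a poly" where
  "q_falling q k = (\<Prod>i<k. [:- q_bracket q i, 1:])"

lemma q_falling_Suc: "q_falling q (Suc k) = ([:0, 1:] - [:q_bracket q k:]) * q_falling q k"
  by (simp add: q_falling_def)

lemma degree_q_falling: "degree (q_falling q k) = k"
  by (simp add: q_falling_def degree_prod_eq_sum_degree)

lemma lead_coeff_q_falling: "lead_coeff (q_falling q k) = 1"
  unfolding q_falling_def lead_coeff_prod by simp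

lemma degree_q_charlier_aux: "degree (q_charlier a q n) = n \<and> coeff (q_charlier a q n) n = 1"
proof (induction a q n rule: q_charlier.induct)
  case (3 a q n)
  define b where "b = a * q ^ Suc n + q_bracket q (Suc n)"
  define f where "f = ([:0, 1:] - [:b:]) * q_charlier a q (Suc n)"
  define g where "g = smult (a * q_bracket q (Suc n) * q ^ n) (q_charlier a q n)"
  note IH = 3[THEN conjunct1] 3[THEN conjunct2]
  have "q_charlier a q (Suc n) \<noteq> 0"
    using IH(1) by (metis degree_0 nat.distinct(1))
  then have "degree f = degree ([:0, 1:] - [:b:]) + degree (q_charlier a q (Suc n))"
    unfolding f_def by (intro degree_mult_eq) simp_all
  then have deg: "degree f = Suc (Suc n)"
    using IH by simp
  have "lead_coeff f = lead_coeff ([:0, 1:] - [:b:]) * lead_coeff (q_charlier a q (Suc n))"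
    unfolding f_def by (rule lead_coeff_mult)
  then have lc: "coeff f (Suc (Suc n)) = 1"
    unfolding deg IH by (simp add: IH)
  have g: "degree g < Suc (Suc n)"
    unfolding g_def
    using degree_smult_le[of "a * q_bracket q (Suc n) * q ^ n" "q_charlier a q n"] IH by linarith
  have "degree (f - g) = Suc (Suc n)"
    using deg g degree_add_eq_left[of "- g" f] by simp
  moreover have "coeff (f - g) (Suc (Suc n)) = 1"
    using lc coeff_eq_0[OF g] by simp
  moreover have "q_charlier a q (Suc (Suc n)) = f - g"
    by (simp only: q_charlier.simps f_def g_def b_def)
  ultimately show ?case
    by simp
qed auto

lemma degree_q_charlier: "degree (q_charlier a q n) = n"
  and lead_coeff_q_charlier: "lead_coeff (q_charlier a q n) = 1"
  using degree_q_charlier_aux[of a q n] by simp_all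

text \<open>The rule \<open>x \<phi> k = \<phi> (k + 1) + [k] \<phi> k\<close> mirrors the recursion
  of \<open>q_stirling\<close>.\<close>

lemma power_eq_sum_q_falling:
  "[:0, 1:] ^ n = (\<Sum>k\<le>n. smult (q_stirling q n k) (q_falling q k))"
proof (induction n)
  case 0
  show ?case
    by (simp add: q_falling_def)
next
  case (Suc n)
  have x: "[:0, 1:] * q_falling q k = q_falling q (Suc k) + smult (q_bracket q k) (q_falling q k)" for k
    by (simp add: q_falling_Suc algebra_simps)
  have "[:0, 1:] ^ Suc n = (\<Sum>k\<le>n. smult (q_stirling q n k) ([:0, 1:] * q_falling q k))"
    by (simp add: Suc sum_distrib_left del: mult_pCons_left)
  also have "\<dots> = (\<Sum>k\<le>n. smult (q_stirling q n k) (q_falling q (Suc k)))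
      + (\<Sum>k\<le>n. smult (q_bracket q k * q_stirling q n k) (q_falling q k))"
    unfolding x by (simp add: smult_add_right sum.distrib mult.commute)
  \<comment> \<open>The added term vanishes because
    \<open>q_stirling q n (Suc n) = 0\<close>.\<close>
  also have "(\<Sum>k\<le>n. smult (q_bracket q k * q_stirling q n k) (q_falling q k)) =
      (\<Sum>k\<le>Suc n. smult (q_bracket q k * q_stirling q n k) (q_falling q k))"
    by (simp add: q_stirling_eq_0)
  \<comment> \<open>The term at \<open>k = 0\<close> drops out because
    \<open>[0] = 0\<close>.\<close>
  also have "\<dots> = (\<Sum>k\<le>n. smult (q_bracket q (Suc k) * q_stirling q n (Suc k)) (q_falling q (Suc k)))"
    by (subst sum.atMost_Suc_shift) simp
  finally show ?case
    by (subst sum.atMost_Suc_shift) (simp add: smult_add_left sum.distrib)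
qed

text \<open>Prescribing these moments reduces the algebraic side to identifying this functional with
  \<open>L_q\<close>.\<close>

definition charlier_functional :: "'a::field \<Rightarrow> 'a \<Rightarrow> 'a poly \<Rightarrow> 'a" where
  "charlier_functional a q = moment_functional (\<lambda>n. \<Sum>k\<le>n. q_stirling q n k * a ^ k)"

lemma linear_charlier_functional: "Vector_Spaces.linear smult (*) (charlier_functional a q)"
  unfolding charlier_functional_def by (rule linear_moment_functional)

lemmas charlier_functional_simps = linear_smultD[OF linear_charlier_functional]

text \<open>The expansion of \<open>x ^ n\<close> is triangular with diagonal coefficient 1, so the
  moment and the values below \<open>n\<close> determine the value at \<open>n\<close>.\<close>

lemma charlier_functional_q_falling: "charlier_functional a q (q_falling q n) = a ^ n"
proof (induction n rule: less_induct)
  case (less n)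
  let ?L = "charlier_functional a q"
  have L_sum: "?L (\<Sum>k<m. f k) = (\<Sum>k<m. ?L (f k))" for m and f :: "nat \<Rightarrow> _"
    by (induction m) (simp_all add: charlier_functional_simps)
  have "(\<Sum>k\<le>n. q_stirling q n k * a ^ k) = ?L ([:0, 1:] ^ n)"
    by (simp add: charlier_functional_def moment_functional_power)
  also have "\<dots> = (\<Sum>k<n. q_stirling q n k * ?L (q_falling q k)) + ?L (q_falling q n)"
    unfolding power_eq_sum_q_falling[of n q]
    by (simp add: L_sum charlier_functional_simps flip: lessThan_Suc_atMost)
  also have "(\<Sum>k<n. q_stirling q n k * ?L (q_falling q k)) = (\<Sum>k<n. q_stirling q n k * a ^ k)"
    using less by simp
  finally show ?case
    by (simp flip: lessThan_Suc_atMost)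
qed

section \<open>Orthogonality and uniqueness\<close>

text \<open>Apart from the factor at \<open>i = 0\<close>, use
  \<open>[k + 1] - [i + 1] = q ([k] - [i])\<close>. This brings the term with
  \<open>q_falling q (Suc k)\<close> back to products at \<open>k\<close>.\<close>

lemma prod_q_bracket_diff_shift:
  fixes q :: "'a::field"
  assumes "q \<noteq> 1"
  shows "(\<Prod>i<Suc n. q_bracket q (Suc k) - q_bracket q i) =
    q_bracket q (Suc k) * q ^ n * (\<Prod>i<n. q_bracket q k - q_bracket q i)"
proof -
  have "q_bracket q (Suc k) - q_bracket q (Suc i) = q * (q_bracket q k - q_bracket q i)" for i
    using assms by (simp add: q_bracket_Suc algebra_simps)
  then show ?thesis
    unfolding prod.lessThan_Suc_shift by (simp add: prod.distrib)
qed

lemma charlier_functional_q_falling_mult_q_charlier: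
  fixes a q :: "'a::field"
  assumes "q \<noteq> 1"
  shows "charlier_functional a q (q_falling q k * q_charlier a q n) =
    a ^ k * (\<Prod>i<n. q_bracket q k - q_bracket q i)"
proof (induction n arbitrary: k rule: less_induct)
  case (less n)
  let ?L = "charlier_functional a q"
  \<comment> \<open>Writing \<open>x - b = (x - [k]) + ([k] - b)\<close> turns the recurrence into
    terms covered by the induction hypothesis, which therefore has to hold for all
    \<open>k\<close>.\<close>
  have x: "q_falling q k * (([:0, 1:] - [:b:]) * f) =
      q_falling q (Suc k) * f + smult (q_bracket q k - b) (q_falling q k * f)" for b f
    by (simp add: q_falling_Suc algebra_simps smult_diff_left)
  consider "n = 0" | "n = Suc 0" | m where "n = Suc (Suc m)"
    by (metis not0_implies_Suc)
  then show ?case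
  proof cases
    case 1
    then show ?thesis
      by (simp add: charlier_functional_q_falling)
  next
    case 2
    \<comment> \<open>Here \<open>b = a\<close>, as the recurrence starts with
      \<open>a q ^ 0 + [0] = a\<close>.\<close>
    then show ?thesis
      using x[of a 1] by (simp add: charlier_functional_simps charlier_functional_q_falling algebra_simps)
  next
    case (3 m)
    let ?P = "\<lambda>k n. \<Prod>i<n. q_bracket q k - q_bracket q i"
    let ?b = "q_bracket q"
    have "q_falling q k * q_charlier a q n =
        q_falling q (Suc k) * q_charlier a q (Suc m)
        + smult (?b k - (a * q ^ Suc m + ?b (Suc m))) (q_falling q k * q_charlier a q (Suc m))
        - smult (a * ?b (Suc m) * q ^ m) (q_falling q k * q_charlier a q m)"
      unfolding 3 q_charlier.simps right_diff_distrib x by simp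
    then have "?L (q_falling q k * q_charlier a q n) =
        a ^ Suc k * ?P (Suc k) (Suc m)
        + (?b k - (a * q ^ Suc m + ?b (Suc m))) * (a ^ k * ?P k (Suc m))
        - a * ?b (Suc m) * q ^ m * (a ^ k * ?P k m)"
      using less[of "Suc m"] less[of m] 3 by (simp only: charlier_functional_simps)
    \<comment> \<open>Everything deviating from the claim has the last parenthesis as a factor,
      which vanishes by \<open>[j + 1] = 1 + q [j]\<close>.\<close>
    also have "\<dots> = a ^ k * ?P k n + a ^ Suc k * q ^ m * ?P k m *
        (?b (Suc k) - q * (?b k - ?b m) - ?b (Suc m))"
      unfolding prod_q_bracket_diff_shift[OF assms] 3 prod.lessThan_Suc by (simp add: algebra_simps)
    also have "?b (Suc k) - q * (?b k - ?b m) - ?b (Suc m) = 0"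
      using assms by (simp add: q_bracket_Suc algebra_simps)
    finally show ?thesis
      by simp
  qed
qed

text \<open>These assumptions keep \<open>a ^ n\<close> and the differences \<open>[n] - [i]\<close>
  with \<open>i < n\<close> nonzero, hence also the values \<open>L (C n * C n)\<close>.\<close>

locale q_charlier_params =
  fixes a q :: "'a::field"
  assumes a_nonzero: "a \<noteq> 0"
    and inj_power_q: "inj (\<lambda>n. q ^ n)"
begin

lemma q_neq_1: "q \<noteq> 1"
  using inj_power_q[THEN injD, of 1 0] by auto

lemma q_bracket_eq_iff: "q_bracket q m = q_bracket q n \<longleftrightarrow> m = n"
  using q_neq_1 inj_power_q[THEN injD, of m n] by (auto simp: q_bracket_def)

text \<open>For \<open>q_falling q i\<close> with \<open>i < n\<close> the product contains the
  factor \<open>[i] - [i] = 0\<close>; linearity does the rest.\<close>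

lemma charlier_functional_lower_degree:
  assumes "degree f < n"
  shows "charlier_functional a q (f * q_charlier a q n) = 0"
  using assms
proof (induction f rule: monic_family_induct[where p = "q_falling q"])
  case (base i)
  then show ?case
    using q_neq_1 by (auto simp: charlier_functional_q_falling_mult_q_charlier)
qed (simp_all add: degree_q_falling lead_coeff_q_falling[simplified degree_q_falling]
      charlier_functional_simps distrib_right)

lemma orthogonal_charlier_functional:
  "orthogonal_wrt (charlier_functional a q) (q_charlier a q)"
  unfolding orthogonal_wrt_def
proof (intro conjI allI impI)
  fix m n :: nat
  let ?L = "charlier_functional a q"
  let ?C = "q_charlier a q"
  assume "m \<noteq> n"
  then consider "m < n" | "n < m"
    by linarith
  then show "?L (?C m * ?C n) = 0"
    using charlier_functional_lower_degree[of "?C m" n] charlier_functional_lower_degree[of "?C n" m]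
    by cases (simp_all add: degree_q_charlier mult.commute)
next
  fix n
  let ?L = "charlier_functional a q"
  let ?C = "q_charlier a q"
  have "?L (?C n * ?C n) = a ^ n * (\<Prod>i<n. q_bracket q n - q_bracket q i)"
  proof (cases n)
    case 0
    then show ?thesis
      using charlier_functional_q_falling_mult_q_charlier[OF q_neq_1, of a 0 0]
      by (simp add: q_falling_def)
  next
    case (Suc m)
    \<comment> \<open>Both polynomials are monic of degree \<open>n\<close>, so replacing one factor
      \<open>?C n\<close> by \<open>q_falling q n\<close> costs only a term that \<open>?L\<close>
      kills.\<close>
    let ?g = "?C n - q_falling q n"
    have "degree ?g \<le> n"
      by (intro degree_diff_le) (simp_all add: degree_q_charlier degree_q_falling)
    moreover have "coeff ?g n = 0"
      using lead_coeff_q_charlier[of a q n] lead_coeff_q_falling[of q n]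
      by (simp add: degree_q_charlier degree_q_falling)
    ultimately have "degree ?g < n"
      using Suc eq_zero_or_degree_less[of ?g n] by auto
    then have "?L (?g * ?C n) = 0"
      by (rule charlier_functional_lower_degree)
    moreover have "?C n * ?C n = q_falling q n * ?C n + ?g * ?C n"
      by (simp add: algebra_simps)
    ultimately show ?thesis
      using q_neq_1
      by (simp add: charlier_functional_simps charlier_functional_q_falling_mult_q_charlier)
  qed
  also have "\<dots> \<noteq> 0"
    using a_nonzero by (auto simp: q_bracket_eq_iff)
  finally show "?L (?C n * ?C n) \<noteq> 0" .
qed

text \<open>Orthogonality to \<open>C 0 = 1\<close> makes both functionals vanish on all later
  \<open>C n\<close>, they agree on 1, and the \<open>C n\<close> span all polynomials.\<close>

lemma orthogonal_functional_unique:
  assumes lin: "Vector_Spaces.linear smult (*) L" "Vector_Spaces.linear smult (*) L'"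
    and one: "L 1 = 1" "L' 1 = 1"
    and orth: "orthogonal_wrt L (q_charlier a q)" "orthogonal_wrt L' (q_charlier a q)"
  shows "L = L'"
proof
  fix f :: "'a poly"
  have *: "K (q_charlier a q (Suc i)) = 0" if "orthogonal_wrt K (q_charlier a q)"
    for K :: "'a poly \<Rightarrow> 'a" and i
  proof -
    have "K (q_charlier a q (Suc i) * q_charlier a q 0) = 0"
      using that unfolding orthogonal_wrt_def by blast
    then show ?thesis
      by simp
  qed
  have "degree f < Suc (degree f)"
    by simp
  then show "L f = L' f"
  proof (induction f rule: monic_family_induct[where p = "q_charlier a q"])
    case (base i)
    then show ?case
      using one *[OF orth(1)] *[OF orth(2)] by (cases i) simp_all
  qed (simp_all add: degree_q_charlier lead_coeff_q_charlier[simplified degree_q_charlier]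
        linear_smultD[OF lin(1)] linear_smultD[OF lin(2)])
qed

end

section \<open>The rational function field and the moments\<close>

lemma Fract_power: "(Fract x 1) ^ n = Fract (x ^ n) 1"
  by (induction n) (simp_all add: One_fract_def)

interpretation ratfun: q_charlier_params var_a var_q
proof
  show "var_a \<noteq> 0"
    by (simp add: var_a_def Zero_fract_def eq_fract)
  show "inj (\<lambda>n. var_q ^ n)"
  proof (rule injI)
    fix m n
    assume "var_q ^ m = var_q ^ n"
    then have "[:0, 1:] ^ m = ([:0, 1:] ^ n :: rat poly poly)"
      by (simp add: var_q_def Fract_power eq_fract)
    \<comment> \<open>The exponent is read off as the degree in the outer variable.\<close>
    then have "degree (monom 1 m :: rat poly poly) = degree (monom 1 n :: rat poly poly)"
      by (simp add: monom_altdef)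
    then show "m = n"
      by (simp add: degree_monom_eq)
  qed
qed

text \<open>Existence and uniqueness of the normalized orthogonal functional resolve the definite
  description in \<open>L_q\<close>.\<close>

lemma L_q_eq_charlier_functional: "L_q = charlier_functional var_a var_q"
proof -
  let ?L = "charlier_functional var_a var_q"
  have "?L 1 = 1"
    using charlier_functional_q_falling[of var_a var_q 0] by (simp add: q_falling_def)
  then show ?thesis
    unfolding L_q_def
    using linear_charlier_functional ratfun.orthogonal_charlier_functional
      ratfun.orthogonal_functional_unique
    by (intro the_equality) blast+
qed

theorem theorem2:
  fixes n :: nat
  shows "L_q ([:0, 1:] ^ n) = (\<Sum>\<pi>\<in>set_partitions n. var_a ^ card \<pi> * var_q ^ rs n \<pi>)"
  unfolding L_q_eq_charlier_functional charlier_functional_def moment_functional_power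
  using sum_set_partitions_rs[OF ratfun.q_neq_1] by simp

end
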